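(* Let $\beta,\gamma>0$ be fixed, let $m=\lfloor\beta n\rfloor$, $p=\gamma/n$ and $\mu=\beta\gamma^2$, and let $\mathbb{G}(n,m,p)$ be the random intersection graph on $n$ vertices. If $\mu=1$, then there is a finite constant $c_1$, depending solely on $\gamma$ and $\beta$, such that, given any $A>1$, for all sufficiently large $n$, $$\mathbb{P}\left(|\mathcal{C}_{\max}|>\lceil An^{2/3}\rceil\right)\leq \frac{c_1}{A^{3/2}}.$$
   Context: The random intersection graph $\mathbb{G}(n,m,p)$ has vertex set $V=\{v_1,\dots,v_n\}$ and is constructed from a random bipartite graph $\mathbb{B}(n,m,p)$ with the two vertex classes $V$ and $\{a_1,\dots,a_m\}$ (the auxiliary vertices), in which each edge $\{a_k,v_i\}$ is present independently with probability $p\in[0,1]$. Two distinct vertices $v_i,v_j$ are adjacent in $\mathbb{G}(n,m,p)$ if and only if there is at least one $a_k$ such that both edges $\{a_k,v_i\}$ and $\{a_k,v_j\}$ are present in $\mathbb{B}(n,m,p)$. $\mathcal{C}_{\max}$ is a connected component of $\mathbb{G}(n,m,p)$ with the maximal number of vertices and $|\mathcal{C}_{\max}|$ is its number of vertices. *)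

theory Defs
  imports "HOL-Probability.Probability"
begin

text \<open>The vertex \<open>v\<^sub>i\<close> is represented by \<open>i \<in> {1..n}\<close>, the auxiliary vertex \<open>a\<^sub>k\<close> by
  \<open>k \<in> {1..m}\<close>; a bipartite graph is a function \<open>B\<close> with \<open>B (k, i)\<close> iff the edge
  \<open>{a\<^sub>k, v\<^sub>i}\<close> is present.\<close>

definition random_bipartite :: "nat \<Rightarrow> nat \<Rightarrow> real \<Rightarrow> (nat \<times> nat \<Rightarrow> bool) pmf" where
  "random_bipartite n m p = Pi_pmf ({1..m} \<times> {1..n}) False (\<lambda>_. bernoulli_pmf p)"

text \<open>The edge set of a simple graph, given as a symmetric irreflexive relation.\<close>

definition intersection_graph :: "nat \<Rightarrow> nat \<Rightarrow> (nat \<times> nat \<Rightarrow> bool) \<Rightarrow> (nat \<times> nat) set" where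
  "intersection_graph n m B =
     {(i, j). i \<in> {1..n} \<and> j \<in> {1..n} \<and> i \<noteq> j \<and> (\<exists>k\<in>{1..m}. B (k, i) \<and> B (k, j))}"

definition random_intersection_graph :: "nat \<Rightarrow> nat \<Rightarrow> real \<Rightarrow> (nat \<times> nat) set pmf" where
  "random_intersection_graph n m p = map_pmf (intersection_graph n m) (random_bipartite n m p)"

definition connected_components :: "'a set \<Rightarrow> ('a \<times> 'a) set \<Rightarrow> 'a set set" where
  "connected_components V E = (\<lambda>v. {u \<in> V. (v, u) \<in> E\<^sup>*}) ` V"

text \<open>Meaningful for finite nonempty \<open>V\<close> only: \<open>Max {}\<close> is unspecified.\<close>

definition max_component_size :: "'a set \<Rightarrow> ('a \<times> 'a) set \<Rightarrow> nat" where
  "max_component_size V E = Max (card ` connected_components V E)"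

end

theory Submission
  imports Defs
begin

text \<open>
  Write \<open>C(v)\<close> for the component of a vertex \<open>v\<close>. If the largest component has more than \<open>t\<close>
  vertices, then at least \<open>t\<close> vertices lie in components of size above \<open>t\<close>. By Markov's
  inequality the probability of this is at most \<open>n / t\<close> times the largest of the probabilities
  \<open>P(|C(v)| > t)\<close>. So it suffices to bound these by a constant times \<open>1 / sqrt t\<close>, which is the tail
  of the total progeny of a critical branching process. With \<open>t = A * n powr (2 / 3)\<close> this gives a
  constant times \<open>A powr (- 3 / 2)\<close>.

  The tail is read off from the generating function: if \<open>0 < \<sigma> < 1\<close> and
  \<open>E \<sigma>\<^bsup>|C(v)|\<^esup> \<ge> 1 - \<delta>\<close>, then Markov's inequality for \<open>1 - \<sigma>\<^bsup>|C(v)|\<^esup>\<close> bounds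
  \<open>P(|C(v)| > t)\<close> by \<open>\<delta> / (1 - \<sigma>\<^sup>t)\<close>. For a branching process the generating function of
  the total progeny solves \<open>x = \<sigma> f(x)\<close>, with \<open>f\<close> that of the offspring distribution. For
  the random graph only one inequality is needed: every subsolution, \<open>x \<le> \<sigma> f(x)\<close>, is a lower
  bound for \<open>E \<sigma>\<^bsup>|C(v)|\<^esup>\<close>. This is \<open>expectation_reach_ge_potential\<close>, stated for
  independent bond percolation on a finite multigraph (here the bipartite graph) and proved by
  induction on the number of edges, revealing a single edge at a time.

  Since the mean offspring is at most one and the offspring variance is bounded away from zero,
  \<open>f(1 - \<delta>) \<ge> 1 - \<delta>\<close> with a surplus of order \<open>\<delta>\<^sup>2\<close>, so \<open>1 - \<delta>\<close> is a subsolution for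
  \<open>\<sigma> = exp (- \<delta>\<^sup>2 / 4)\<close> once \<open>n\<close> is large (\<open>critical_subsolution\<close>). The choice
  \<open>\<delta> = 2 / sqrt t\<close> makes \<open>\<sigma>\<^sup>t = 1 / e\<close> and yields \<open>P(|C(v)| > t) \<le> 4 / sqrt t\<close>, and finally
  the absolute constant \<open>c\<^sub>1 = 4\<close>.
\<close>

section \<open>Weighted reachability in bond percolation\<close>

lemma finite_set_Pi_pmf_bool:
  fixes P :: "'a \<Rightarrow> bool pmf"
  assumes "finite D"
  shows "finite (set_pmf (Pi_pmf D b P))"
  using assms by (simp add: set_Pi_pmf finite_PiE_dflt)

text \<open>A finite multigraph whose edge \<open>e\<close> joins \<open>l e\<close> and \<open>r e\<close> and is open with
  probability \<open>q e\<close>. Each reached vertex \<open>x\<close> costs a factor \<open>s x\<close>; the number \<open>F x\<close> is a candidate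
  lower bound for the expected product of these factors over everything reached from \<open>x\<close>.\<close>

locale percolation =
  fixes l r :: "'e \<Rightarrow> 'v" and q :: "'e \<Rightarrow> real" and E :: "'e set"
    and s F :: "'v \<Rightarrow> real"
  assumes finite_E: "finite E"
    and no_loop: "e \<in> E \<Longrightarrow> l e \<noteq> r e"
    and q_prob: "0 \<le> q e" "q e \<le> 1"
    and s_bounds: "0 \<le> s x" "s x \<le> 1"
    and F_bounds: "0 \<le> F x" "F x \<le> 1"
begin

definition links :: "'e set \<Rightarrow> ('e \<Rightarrow> bool) \<Rightarrow> ('v \<times> 'v) set" where
  "links D B = (\<Union>e\<in>{e\<in>D. B e}. {(l e, r e), (r e, l e)})"

definition reach :: "'e set \<Rightarrow> ('e \<Rightarrow> bool) \<Rightarrow> 'v set \<Rightarrow> 'v set" where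
  "reach D B A = (links D B)\<^sup>* `` A"

text \<open>For an edge leaving \<open>A\<close>, with outer end \<open>y\<close>: the mean factor it contributes if \<open>y\<close>, once
  reached through it, contributes \<open>F y\<close>. An edge inside \<open>A\<close> can reach nothing new, and one
  outside \<open>A\<close> is charged only when one of its ends is reached.\<close>

definition crossing :: "'v set \<Rightarrow> 'e \<Rightarrow> real" where
  "crossing A e = (if l e \<in> A \<and> r e \<notin> A then 1 - q e + q e * F (r e)
                   else if r e \<in> A \<and> l e \<notin> A then 1 - q e + q e * F (l e) else 1)"

text \<open>The estimate for the expected weight of the set reached from \<open>A\<close> when the edges still to be
  revealed are those in \<open>D\<close>: the vertices of \<open>A\<close> are paid for, and the edges leaving \<open>A\<close> are
  treated as if they led to disjoint independent clusters.\<close>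

definition potential :: "'e set \<Rightarrow> 'v set \<Rightarrow> real" where
  "potential D A = (\<Prod>x\<in>A. s x) * (\<Prod>e\<in>D. crossing A e)"

lemma convex_unit: "0 \<le> 1 - q e + q e * F x" "1 - q e + q e * F x \<le> 1"
proof -
  have "0 \<le> q e * F x" using q_prob F_bounds by simp
  then show "0 \<le> 1 - q e + q e * F x" using q_prob(2)[of e] by linarith
  show "1 - q e + q e * F x \<le> 1"
    using mult_left_le[OF F_bounds(2)[of x] q_prob(1)[of e]] by linarith
qed

lemma crossing_bounds: "0 \<le> crossing A e" "crossing A e \<le> 1"
  unfolding crossing_def using convex_unit by auto

lemma potential_nonneg: "0 \<le> potential D A"
  unfolding potential_def by (intro mult_nonneg_nonneg prod_nonneg) (simp_all add: crossing_bounds s_bounds)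

lemma reach_self: "A \<subseteq> reach D B A"
  unfolding reach_def by auto

lemma reach_least:
  assumes "A \<subseteq> S" and "\<And>x y. (x, y) \<in> links D B \<Longrightarrow> x \<in> S \<Longrightarrow> y \<in> S"
  shows "reach D B A \<subseteq> S"
proof
  fix y assume "y \<in> reach D B A"
  then obtain x where "x \<in> A" "(x, y) \<in> (links D B)\<^sup>*" unfolding reach_def by auto
  from this(2) this(1) show "y \<in> S"
    by (induction rule: rtrancl_induct) (use assms in auto)
qed

lemma reach_closed: "x \<in> reach D B A \<Longrightarrow> (x, y) \<in> links D B \<Longrightarrow> y \<in> reach D B A"
  unfolding reach_def by (auto intro: rtrancl_into_rtrancl)

lemma finite_reach:
  assumes "finite D" "finite A"
  shows "finite (reach D B A)"
proof (rule finite_subset)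
  show "reach D B A \<subseteq> A \<union> l ` D \<union> r ` D"
    by (rule reach_least) (auto simp: links_def)
qed (use assms in auto)

text \<open>The next two lemmas describe the effect of revealing one edge: it is removed from the graph,
  and if it turns out to be open, its far end joins the starting set. Only these inclusions are
  needed, because a larger reached set has a smaller weight.\<close>

lemma reach_reveal_closed:
  assumes "e \<notin> D"
  shows "reach (insert e D) (f(e := False)) A \<subseteq> reach D f A"
proof (rule reach_least[OF reach_self])
  fix x y assume "(x, y) \<in> links (insert e D) (f(e := False))" "x \<in> reach D f A"
  then show "y \<in> reach D f A"
    using assms reach_closed[of x D f A y] by (auto simp: links_def split: if_splits)
qed

lemma reach_reveal_open:
  assumes "e \<notin> D" "{l e, r e} \<subseteq> insert y A"
  shows "reach (insert e D) (f(e := True)) A \<subseteq> reach D f (insert y A)"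
proof (rule reach_least)
  show "A \<subseteq> reach D f (insert y A)" using reach_self[of "insert y A" D f] by auto
  fix u v assume uv: "(u, v) \<in> links (insert e D) (f(e := True))" "u \<in> reach D f (insert y A)"
  have "(u, v) \<in> links D f \<or> v \<in> insert y A"
    using uv(1) assms by (auto simp: links_def split: if_splits)
  then show "v \<in> reach D f (insert y A)"
    using reach_closed[OF uv(2)] reach_self by blast
qed

lemma prod_s_antimono:
  assumes "finite T" "S \<subseteq> T"
  shows "(\<Prod>x\<in>T. s x) \<le> (\<Prod>x\<in>S. s x)"
proof -
  have "(\<Prod>x\<in>T. s x) = (\<Prod>x\<in>T - S. s x) * (\<Prod>x\<in>S. s x)"
    by (rule prod.subset_diff[OF assms(2,1)])
  also have "\<dots> \<le> 1 * (\<Prod>x\<in>S. s x)"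
    by (intro mult_right_mono prod_le_1 prod_nonneg) (simp_all add: s_bounds)
  finally show ?thesis by simp
qed

end

text \<open>The potential of a single vertex is the right-hand side of the fixed-point equation of a
  branching process: \<open>s y\<close> times the product over the edges at \<open>y\<close> of the mean factor
  \<open>1 - q e + q e * F x\<close>.\<close>

locale percolation_subsolution = percolation +
  assumes subsolution: "F y \<le> potential E {y}"
begin

text \<open>The product on the left counts an edge between \<open>A\<close> and \<open>y\<close> twice, once from either end,
  whereas it no longer leaves \<open>insert y A\<close>. Cycles thus only help the lower bound.\<close>

lemma crossing_insert:
  assumes "e \<in> E" "y \<notin> A"
  shows "crossing A e * crossing {y} e \<le> crossing (insert y A) e"
proof (cases "crossing (insert y A) e = 1")
  case True
  then show ?thesis by (simp add: crossing_bounds mult_le_one)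
next
  case False
  then show ?thesis
    using no_loop[OF assms(1)] assms(2) by (auto simp: crossing_def split: if_splits)
qed

lemma potential_insert:
  assumes "D \<subseteq> E" "finite A" "y \<notin> A"
  shows "potential D A * F y \<le> potential D (insert y A)"
proof -
  have fin: "finite D" using assms(1) finite_E finite_subset by blast
  have "(\<Prod>e\<in>E. crossing {y} e) = (\<Prod>e\<in>E - D. crossing {y} e) * (\<Prod>e\<in>D. crossing {y} e)"
    by (rule prod.subset_diff[OF assms(1) finite_E])
  also have "\<dots> \<le> 1 * (\<Prod>e\<in>D. crossing {y} e)"
    by (intro mult_right_mono prod_le_1 prod_nonneg) (simp_all add: crossing_bounds)
  finally have "F y \<le> s y * (\<Prod>e\<in>D. crossing {y} e)"
    using subsolution[of y] s_bounds(1)[of y] unfolding potential_def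
    by (simp add: mult_left_mono order_trans)
  then have "potential D A * F y \<le> potential D A * (s y * (\<Prod>e\<in>D. crossing {y} e))"
    by (rule mult_left_mono[OF _ potential_nonneg])
  also have "\<dots> = (\<Prod>x\<in>insert y A. s x) * (\<Prod>e\<in>D. crossing A e * crossing {y} e)"
    using assms by (simp add: potential_def prod.distrib mult_ac)
  also have "\<dots> \<le> (\<Prod>x\<in>insert y A. s x) * (\<Prod>e\<in>D. crossing (insert y A) e)"
    by (intro mult_left_mono prod_mono prod_nonneg conjI mult_nonneg_nonneg)
       (use assms in \<open>auto simp: crossing_bounds s_bounds crossing_insert\<close>)
  finally show ?thesis by (simp add: potential_def)
qed

text \<open>Induction on the number of unrevealed edges. If no edge leaves \<open>A\<close>, both sides are the weight
  of \<open>A\<close>. Otherwise reveal an edge \<open>e\<close> from \<open>A\<close> to some \<open>y\<close> outside: with probability \<open>1 - q e\<close> the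
  potential loses only the factor of \<open>e\<close>, and with probability \<open>q e\<close> it is in addition multiplied by at
  least \<open>F y\<close>. The factor of \<open>e\<close> is the mean of these two multipliers.\<close>

theorem expectation_reach_ge_potential:
  assumes "D \<subseteq> E" "finite A"
  shows "potential D A \<le> measure_pmf.expectation (Pi_pmf D False (\<lambda>e. bernoulli_pmf (q e)))
           (\<lambda>B. \<Prod>x\<in>reach D B A. s x)"
  using assms
proof (induction "card D" arbitrary: D A)
  case 0
  then have D: "D = {}" using finite_E finite_subset[of D E] by auto
  have "reach {} B A = A" for B by (auto simp: reach_def links_def)
  then show ?case by (simp add: D potential_def)
next
  case (Suc n)
  have finD: "finite D" using Suc.prems finite_E finite_subset by blast
  show ?case
  proof (cases "\<exists>e\<in>D. \<exists>y. y \<notin> A \<and> (l e \<in> A \<and> r e = y \<or> r e \<in> A \<and> l e = y)")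
    case False
    have eq: "reach D B A = A" for B
    proof (rule antisym[OF reach_least reach_self])
      fix x y assume "(x, y) \<in> links D B" "x \<in> A"
      then show "y \<in> A" using False by (auto simp: links_def)
    qed auto
    have "(\<Prod>e\<in>D. crossing A e) = 1"
      by (rule prod.neutral) (use False in \<open>auto simp: crossing_def\<close>)
    then show ?thesis by (simp add: eq potential_def)
  next
    case True
    then obtain e y where e: "e \<in> D" "y \<notin> A" "l e \<in> A \<and> r e = y \<or> r e \<in> A \<and> l e = y" by blast
    define D' where "D' = D - {e}"
    have D': "D = insert e D'" "e \<notin> D'" "finite D'" "n = card D'" "D' \<subseteq> E"
      using e(1) finD Suc.hyps(2) Suc.prems(1) by (auto simp: D'_def)
    have finA: "finite A" by fact
    let ?P = "Pi_pmf D' False (\<lambda>e. bernoulli_pmf (q e))"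
    let ?g = "\<lambda>D A B. \<Prod>x\<in>reach D B A. s x"
    have fin_P: "finite (set_pmf ?P)"
      by (rule finite_set_Pi_pmf_bool[OF D'(3)])
    have int: "integrable (measure_pmf ?P) h" for h :: "('a \<Rightarrow> bool) \<Rightarrow> real"
      by (rule integrable_measure_pmf_finite[OF fin_P])
    have step0: "potential D' A \<le> measure_pmf.expectation ?P (\<lambda>f. ?g D A (f(e := False)))"
    proof (rule order_trans[OF Suc.hyps(1)[OF D'(4,5) finA]], rule integral_mono[OF int int])
      fix f show "?g D' A f \<le> ?g D A (f(e := False))"
        unfolding D'(1)
        by (rule prod_s_antimono[OF finite_reach[OF D'(3) finA] reach_reveal_closed[OF D'(2)]])
    qed
    have step1: "potential D' (insert y A) \<le> measure_pmf.expectation ?P (\<lambda>f. ?g D A (f(e := True)))"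
    proof (rule order_trans[OF Suc.hyps(1)[OF D'(4,5), of "insert y A"]])
      show "finite (insert y A)" using finA by simp
      show "measure_pmf.expectation ?P (?g D' (insert y A)) \<le> measure_pmf.expectation ?P (\<lambda>f. ?g D A (f(e := True)))"
      proof (rule integral_mono[OF int int])
        fix f show "?g D' (insert y A) f \<le> ?g D A (f(e := True))"
          unfolding D'(1)
          by (rule prod_s_antimono[OF finite_reach reach_reveal_open[OF D'(2)]])
             (use e D' finA in auto)
      qed
    qed
    have cross: "crossing A e = 1 - q e + q e * F y"
      using e by (auto simp: crossing_def)
    have "potential D A = potential D' A * crossing A e"
      using D' by (simp add: potential_def mult_ac)
    also have "\<dots> = q e * (potential D' A * F y) + (1 - q e) * potential D' A"
      by (simp add: cross algebra_simps)
    also have "\<dots> \<le> q e * potential D' (insert y A) + (1 - q e) * potential D' A"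
      using potential_insert[OF D'(5) finA e(2)] q_prob(1)[of e] by (simp add: mult_left_mono)
    also have "\<dots> \<le> q e * measure_pmf.expectation ?P (\<lambda>f. ?g D A (f(e := True)))
                   + (1 - q e) * measure_pmf.expectation ?P (\<lambda>f. ?g D A (f(e := False)))"
      using step0 step1 q_prob[of e] by (intro add_mono mult_left_mono) auto
    also have "\<dots> = measure_pmf.expectation (bernoulli_pmf (q e))
                       (\<lambda>b. measure_pmf.expectation ?P (\<lambda>f. ?g D A (f(e := b))))"
      using q_prob by simp
    also have "\<dots> = measure_pmf.expectation (Pi_pmf D False (\<lambda>e. bernoulli_pmf (q e))) (?g D A)"
    proof -
      have fin: "finite (set_pmf (map_pmf (\<lambda>f. f(e := b)) ?P))" for b
        using fin_P by simp
      have "Pi_pmf D False (\<lambda>e. bernoulli_pmf (q e))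
            = bernoulli_pmf (q e) \<bind> (\<lambda>b. map_pmf (\<lambda>f. f(e := b)) ?P)"
        unfolding D'(1) by (simp add: Pi_pmf_insert'[OF D'(3,2)] map_pmf_def)
      then show ?thesis
        by (simp add: pmf_expectation_bind[OF finite[of UNIV] fin]) (simp add: UNIV_bool q_prob)
    qed
    finally show ?thesis .
  qed
qed

end

section \<open>The generating-function inequality at criticality\<close>

lemma one_minus_le_exp_quadratic:
  fixes x :: real
  assumes "0 \<le> x"
  shows "1 - x \<le> exp (- x - x\<^sup>2 / 2)"
proof -
  have "(1 - x) * exp (x + x\<^sup>2 / 2) \<le> (1 - 0) * exp (0 + 0\<^sup>2 / 2)"
  proof (rule DERIV_nonpos_imp_nonincreasing[OF assms])
    fix t :: real
    have "((\<lambda>t. (1 - t) * exp (t + t\<^sup>2 / 2)) has_real_derivative - (t\<^sup>2) * exp (t + t\<^sup>2 / 2)) (at t)"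
      by (auto intro!: derivative_eq_intros simp: algebra_simps power2_eq_square)
    then show "\<exists>y. ((\<lambda>t. (1 - t) * exp (t + t\<^sup>2 / 2)) has_real_derivative y) (at t) \<and> y \<le> 0"
      by (intro exI conjI) auto
  qed
  then have "(1 - x) \<le> 1 / exp (x + x\<^sup>2 / 2)"
    by (simp add: field_simps)
  also have "\<dots> = exp (- (x + x\<^sup>2 / 2))" by (simp only: exp_minus inverse_eq_divide)
  finally show ?thesis by simp
qed

text \<open>The map \<open>x \<mapsto> (1 - p + p * (1 - p + p * x) ^ n) ^ m\<close> is the generating function of the number of
  grandchildren in a two-type branching process, whose mean \<open>m n p\<^sup>2\<close> is at most \<open>1\<close> by the assumption
  on \<open>m\<close>. The inner power may be linearised; the gain quadratic in \<open>\<delta>\<close> comes from the outer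
  one, which is at least \<open>exp (- \<delta> - \<delta>\<^sup>2 / 4)\<close>, while \<open>1 - \<delta> \<le> exp (- \<delta> - \<delta>\<^sup>2 / 2)\<close>. The factor
  \<open>exp (- \<delta>\<^sup>2 / 4)\<close> is the room between the two.\<close>

lemma critical_subsolution:
  fixes n m :: nat and p \<gamma> \<delta> :: real
  assumes "0 < \<gamma>" "8 * \<gamma>\<^sup>2 \<le> real n" "\<gamma> \<le> real n" "0 < n" "real m * \<gamma>\<^sup>2 \<le> real n"
    and "0 \<le> \<delta>" "\<delta> \<le> 1" and p: "p = \<gamma> / real n"
  shows "1 - \<delta> \<le> exp (- \<delta>\<^sup>2 / 4) * (1 - p + p * (1 - p * \<delta>) ^ n) ^ m"
proof -
  \<comment> \<open>Linearising the inner power turns the base of the outer one into \<open>1 - y\<close>. The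
    assumption \<open>8 * \<gamma>\<^sup>2 \<le> n\<close> makes \<open>y \<le> \<delta> / 8\<close>, so that \<open>2 * m * y\<^sup>2 \<le> \<delta>\<^sup>2 / 4\<close>.\<close>
  define y where "y = \<gamma>\<^sup>2 * \<delta> / real n"
  have p01: "0 \<le> p" "p \<le> 1" using assms by (auto simp: p field_simps)
  have y0: "0 \<le> y" using assms by (simp add: y_def)
  have y8: "y \<le> \<delta> / 8"
  proof -
    have "8 * \<gamma>\<^sup>2 * \<delta> \<le> real n * \<delta>" using assms by (intro mult_right_mono) auto
    then show ?thesis using assms by (simp add: y_def field_simps)
  qed
  have my: "real m * y \<le> \<delta>"
  proof -
    have "real m * \<gamma>\<^sup>2 * \<delta> \<le> real n * \<delta>" using assms by (intro mult_right_mono) auto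
    then show ?thesis using assms by (simp add: y_def field_simps)
  qed
  have "p * \<delta> \<le> 1" using p01 assms mult_le_one by blast
  then have "1 + real n * (- (p * \<delta>)) \<le> (1 + - (p * \<delta>)) ^ n"
    by (intro Bernoulli_inequality) simp
  then have "p * (1 - real n * p * \<delta>) \<le> p * (1 - p * \<delta>) ^ n"
    using p01 by (intro mult_left_mono) (auto simp: mult.assoc)
  moreover have "p * (real n * p * \<delta>) = y"
    using assms by (simp add: p y_def power2_eq_square)
  ultimately have base: "1 - y \<le> 1 - p + p * (1 - p * \<delta>) ^ n"
    by (simp add: algebra_simps)
  have y1: "y \<le> 1/2" using y8 assms by simp
  have "- \<delta> - \<delta>\<^sup>2 / 4 \<le> real m * (- y - 2 * y\<^sup>2)"
  proof -
    have "(real m * y) * (2 * y) \<le> \<delta> * (2 * (\<delta> / 8))"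
      using my y8 y0 assms by (intro mult_mono) auto
    then show ?thesis using my by (simp add: algebra_simps power2_eq_square)
  qed
  also have "\<dots> \<le> real m * ln (1 - y)"
    using ln_one_minus_pos_lower_bound[OF y0 y1] by (intro mult_left_mono) auto
  finally have "exp (- \<delta> - \<delta>\<^sup>2 / 4) \<le> exp (real m * ln (1 - y))" by simp
  also have "\<dots> = (1 - y) ^ m"
    using y1 by (simp add: exp_of_nat_mult)
  also have "\<dots> \<le> (1 - p + p * (1 - p * \<delta>) ^ n) ^ m"
    using base y1 by (intro power_mono) auto
  finally have "exp (- \<delta>\<^sup>2 / 4) * exp (- \<delta> - \<delta>\<^sup>2 / 4) \<le> exp (- \<delta>\<^sup>2 / 4) * (1 - p + p * (1 - p * \<delta>) ^ n) ^ m"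
    by simp
  moreover have "exp (- \<delta>\<^sup>2 / 4) * exp (- \<delta> - \<delta>\<^sup>2 / 4) = exp (- \<delta> - \<delta>\<^sup>2 / 2)"
    by (simp flip: exp_add)
  ultimately show ?thesis using one_minus_le_exp_quadratic[OF assms(6)] by linarith
qed

section \<open>Components of the random intersection graph\<close>

lemma sym_intersection_graph: "sym (intersection_graph n m B)"
  unfolding sym_def intersection_graph_def by auto

definition component :: "nat \<Rightarrow> nat \<Rightarrow> (nat \<times> nat \<Rightarrow> bool) \<Rightarrow> nat \<Rightarrow> nat set" where
  "component n m B v = {u \<in> {1..n}. (v, u) \<in> (intersection_graph n m B)\<^sup>*}"

lemma finite_set_random_bipartite: "finite (set_pmf (random_bipartite n m p))"
  unfolding random_bipartite_def by (rule finite_set_Pi_pmf_bool) simp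

text \<open>Percolation on the complete bipartite graph, where only the vertices of the intersection
  graph carry a weight. The subsolution is \<open>1 - \<delta>\<close> at these, and at an auxiliary vertex it is the
  exact solution given that value, \<open>(1 - p \<delta>)\<^sup>n\<close>.\<close>

lemma expectation_component_ge:
  fixes n m v :: nat and p \<sigma> \<delta> :: real
  assumes p: "0 \<le> p" "p \<le> 1" and \<sigma>: "0 \<le> \<sigma>" "\<sigma> \<le> 1" and \<delta>: "0 \<le> \<delta>" "\<delta> \<le> 1"
    and sub: "1 - \<delta> \<le> \<sigma> * (1 - p + p * (1 - p * \<delta>) ^ n) ^ m"
    and v: "v \<in> {1..n}"
  shows "1 - \<delta> \<le> measure_pmf.expectation (random_bipartite n m p) (\<lambda>B. \<sigma> ^ card (component n m B v))"
proof -
  define l :: "nat \<times> nat \<Rightarrow> nat + nat" where "l = (\<lambda>e. Inl (fst e))"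
  define r :: "nat \<times> nat \<Rightarrow> nat + nat" where "r = (\<lambda>e. Inr (snd e))"
  define E where "E = {1..m} \<times> {1..n}"
  define s :: "nat + nat \<Rightarrow> real" where "s = (\<lambda>x. case x of Inl _ \<Rightarrow> 1 | Inr _ \<Rightarrow> \<sigma>)"
  \<comment> \<open>The value 0 at labels that are no vertices makes the subsolution inequality trivial there.\<close>
  define F :: "nat + nat \<Rightarrow> real" where
    "F = (\<lambda>x. case x of Inl k \<Rightarrow> if k \<in> {1..m} then (1 - p * \<delta>) ^ n else 0
                      | Inr i \<Rightarrow> if i \<in> {1..n} then 1 - \<delta> else 0)"
  have pd: "0 \<le> 1 - p * \<delta>" "1 - p * \<delta> \<le> 1" using p \<delta> mult_le_one[of p \<delta>] by auto
  interpret percolation l r "\<lambda>_. p" E s F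
    by unfold_locales
       (use p \<sigma> \<delta> pd in \<open>auto simp: E_def l_def r_def s_def F_def power_le_one split: sum.splits\<close>)
  interpret percolation_subsolution l r "\<lambda>_. p" E s F
  proof
    fix y show "F y \<le> potential E {y}"
    proof (cases y)
      case (Inl k)
      have "(\<Prod>e\<in>E. crossing {y} e) = (\<Prod>e\<in>E. if fst e = k then 1 - p * \<delta> else 1)"
        unfolding crossing_def by (rule prod.cong) (auto simp: E_def Inl l_def r_def F_def algebra_simps)
      also have "\<dots> = (\<Prod>a\<in>{1..m}. if a = k then (1 - p * \<delta>) ^ n else 1)"
        unfolding E_def by (simp add: prod.cartesian_product' if_distrib[of "\<lambda>x. x ^ n"] cong: if_cong)
      finally have prod: "(\<Prod>e\<in>E. crossing {y} e) = (if k \<in> {1..m} then (1 - p * \<delta>) ^ n else 1)"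
        by simp
      show ?thesis
        unfolding potential_def prod using pd by (simp add: Inl F_def s_def)
    next
      case (Inr i)
      have "(\<Prod>e\<in>E. crossing {y} e) = (\<Prod>e\<in>E. if snd e = i then 1 - p + p * (1 - p * \<delta>) ^ n else 1)"
        unfolding crossing_def by (rule prod.cong) (auto simp: E_def Inr l_def r_def F_def)
      also have "\<dots> = (\<Prod>a\<in>{1..m}. \<Prod>b\<in>{1..n}. if b = i then 1 - p + p * (1 - p * \<delta>) ^ n else 1)"
        unfolding E_def by (simp add: prod.cartesian_product')
      finally have prod: "(\<Prod>e\<in>E. crossing {y} e)
          = (if i \<in> {1..n} then (1 - p + p * (1 - p * \<delta>) ^ n) ^ m else 1)"
        by simp
      show ?thesis
        unfolding potential_def prod using sub \<sigma> by (simp add: Inr F_def s_def)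
    qed
  qed
  have le: "(\<Prod>x\<in>reach E B {Inr v}. s x) \<le> \<sigma> ^ card (component n m B v)" for B
  proof -
    \<comment> \<open>One step in the intersection graph is two steps in the bipartite graph.\<close>
    have "Inr u \<in> reach E B {Inr v}" if "(v, u) \<in> (intersection_graph n m B)\<^sup>*" for u
      using that
    proof (induction rule: rtrancl_induct)
      case base
      show ?case using reach_self[of "{Inr v}" E B] by simp
    next
      case (step u w)
      then obtain k where "(k, u) \<in> E" "(k, w) \<in> E" "B (k, u)" "B (k, w)"
        by (auto simp: intersection_graph_def E_def)
      then have "(Inr u, Inl k) \<in> links E B" "(Inl k, Inr w) \<in> links E B"
        unfolding links_def by (force simp: l_def r_def)+
      then show ?case using step.IH reach_closed by blast
    qed
    then have "Inr ` component n m B v \<subseteq> reach E B {Inr v}"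
      by (auto simp: component_def)
    then have "(\<Prod>x\<in>reach E B {Inr v}. s x) \<le> (\<Prod>x\<in>Inr ` component n m B v. s x)"
      by (rule prod_s_antimono[rotated]) (simp add: finite_reach finite_E)
    also have "\<dots> = \<sigma> ^ card (component n m B v)"
      by (simp add: prod.reindex s_def)
    finally show ?thesis .
  qed
  have "1 - \<delta> = F (Inr v)" using v by (simp add: F_def)
  also have "\<dots> \<le> potential E {Inr v}" by (rule subsolution)
  also have "\<dots> \<le> measure_pmf.expectation (random_bipartite n m p) (\<lambda>B. \<Prod>x\<in>reach E B {Inr v}. s x)"
    using expectation_reach_ge_potential[of E "{Inr v}"] by (simp add: random_bipartite_def E_def)
  also have "\<dots> \<le> measure_pmf.expectation (random_bipartite n m p) (\<lambda>B. \<sigma> ^ card (component n m B v))"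
    by (intro integral_mono integrable_measure_pmf_finite finite_set_random_bipartite le)
  finally show ?thesis .
qed

text \<open>Markov's inequality for \<open>1 - \<sigma>\<^bsup>|C(v)|\<^esup>\<close>, which is at least \<open>1 - 1 / e \<ge> 1 / 2\<close> when
  \<open>|C(v)| > t\<close>. The hypothesis \<open>4 \<le> t\<close> ensures \<open>\<delta> \<le> 1\<close>.\<close>

lemma prob_large_component:
  fixes n m v :: nat and \<gamma> t :: real
  assumes "0 < \<gamma>" "8 * \<gamma>\<^sup>2 \<le> real n" "\<gamma> \<le> real n" "real m * \<gamma>\<^sup>2 \<le> real n"
    and v: "v \<in> {1..n}" and t: "4 \<le> t"
  shows "measure_pmf.prob (random_bipartite n m (\<gamma> / real n)) {B. t < real (card (component n m B v))}
           \<le> 4 / sqrt t"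
proof -
  define \<delta> where "\<delta> = 2 / sqrt t"
  define \<sigma> where "\<sigma> = exp (- \<delta>\<^sup>2 / 4)"
  let ?P = "random_bipartite n m (\<gamma> / real n)" and ?X = "\<lambda>B. card (component n m B v)"
  have int: "integrable (measure_pmf ?P) h" for h :: "_ \<Rightarrow> real"
    by (rule integrable_measure_pmf_finite[OF finite_set_random_bipartite])
  have "sqrt 4 \<le> sqrt t" using t by (rule real_sqrt_le_mono)
  then have \<delta>: "0 \<le> \<delta>" "\<delta> \<le> 1" using t by (auto simp: \<delta>_def field_simps)
  have \<delta>t: "\<delta>\<^sup>2 * t = 4" using t by (simp add: \<delta>_def power_divide)
  have \<sigma>: "0 \<le> \<sigma>" "\<sigma> \<le> 1" by (auto simp: \<sigma>_def)
  have E: "1 - \<delta> \<le> measure_pmf.expectation ?P (\<lambda>B. \<sigma> ^ ?X B)"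
  proof (rule expectation_component_ge[OF _ _ \<sigma> \<delta> _ v])
    show "1 - \<delta> \<le> \<sigma> * (1 - \<gamma> / real n + \<gamma> / real n * (1 - \<gamma> / real n * \<delta>) ^ n) ^ m"
      unfolding \<sigma>_def by (rule critical_subsolution[of \<gamma>]) (use assms \<delta> in auto)
  qed (use assms in auto)
  have "indicator {B. t < real (?X B)} B / 2 \<le> 1 - \<sigma> ^ ?X B" for B
  proof (cases "t < real (?X B)")
    case True
    have "\<sigma> ^ ?X B = exp (- (\<delta>\<^sup>2 * real (?X B) / 4))"
      unfolding \<sigma>_def by (simp flip: exp_of_nat_mult)
    also have "\<dots> \<le> exp (- 1)"
      using mult_left_mono[of t "real (?X B)" "\<delta>\<^sup>2"] True \<delta>t by simp
    also have "\<dots> \<le> 1 / 2"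
      using exp_ge_add_one_self[of "1::real"] by (simp add: exp_minus field_simps)
    finally show ?thesis using True by simp
  next
    case False
    then show ?thesis using power_le_one[OF \<sigma>] by simp
  qed
  then have "measure_pmf.expectation ?P (\<lambda>B. indicator {B. t < real (?X B)} B / 2)
             \<le> measure_pmf.expectation ?P (\<lambda>B. 1 - \<sigma> ^ ?X B)"
    by (intro integral_mono int)
  also have "\<dots> = 1 - measure_pmf.expectation ?P (\<lambda>B. \<sigma> ^ ?X B)"
    by (subst Bochner_Integration.integral_diff) (auto intro: int)
  finally show ?thesis using E by (simp add: \<delta>_def)
qed

lemma many_vertices_in_large_components:
  assumes n: "0 < n" and t: "t < real (max_component_size {1..n} (intersection_graph n m B))"
  shows "t \<le> real (card {v \<in> {1..n}. t < real (card (component n m B v))})"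
proof -
  let ?E = "intersection_graph n m B"
  have "connected_components {1..n} ?E = component n m B ` {1..n}"
    by (simp add: connected_components_def component_def)
  moreover have "max_component_size {1..n} ?E \<in> card ` connected_components {1..n} ?E"
    unfolding max_component_size_def using n by (intro Max_in) (auto simp: connected_components_def)
  ultimately obtain v where v: "v \<in> {1..n}" "t < real (card (component n m B v))"
    using t by auto
  have same: "component n m B u = component n m B v" if "u \<in> component n m B v" for u
  proof -
    have "(v, u) \<in> ?E\<^sup>*" using that by (simp add: component_def)
    moreover have "(u, v) \<in> ?E\<^sup>*"
      using calculation sym_rtrancl[OF sym_intersection_graph] by (meson symD)
    ultimately show ?thesis unfolding component_def by (auto intro: rtrancl_trans)
  qed
  have "component n m B v \<subseteq> {u \<in> {1..n}. t < real (card (component n m B u))}"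
    using v same by (auto simp: component_def[of n m B v])
  then have "card (component n m B v) \<le> card {u \<in> {1..n}. t < real (card (component n m B u))}"
    by (intro card_mono) auto
  then show ?thesis using v by linarith
qed

text \<open>The first moment of the number of vertices in components larger than \<open>t\<close>.\<close>

lemma prob_max_component:
  fixes n m :: nat and \<gamma> t :: real
  assumes "0 < \<gamma>" "8 * \<gamma>\<^sup>2 \<le> real n" "\<gamma> \<le> real n" "real m * \<gamma>\<^sup>2 \<le> real n" and t: "4 \<le> t"
  shows "measure_pmf.prob (random_intersection_graph n m (\<gamma> / real n))
           {E. t < real (max_component_size {1..n} E)} \<le> 4 * real n / t powr (3 / 2)"
proof -
  let ?P = "random_bipartite n m (\<gamma> / real n)"
  let ?L = "\<lambda>v. {B. t < real (card (component n m B v))}"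
  let ?M = "{B. t < real (max_component_size {1..n} (intersection_graph n m B))}"
  have n: "0 < n" using assms by (cases n) auto
  have int: "integrable (measure_pmf ?P) h" for h :: "_ \<Rightarrow> real"
    by (rule integrable_measure_pmf_finite[OF finite_set_random_bipartite])
  have "t * indicator ?M B \<le> (\<Sum>v\<in>{1..n}. indicator (?L v) B :: real)" for B
  proof (cases "B \<in> ?M")
    case True
    have "(\<Sum>v\<in>{1..n}. indicator (?L v) B :: real) = real (card {v \<in> {1..n}. B \<in> ?L v})"
      by (simp add: indicator_def sum.If_cases Int_def)
    then show ?thesis using True many_vertices_in_large_components[OF n, of t m B] by simp
  qed (simp add: sum_nonneg)
  then have "measure_pmf.expectation ?P (\<lambda>B. t * indicator ?M B)
      \<le> measure_pmf.expectation ?P (\<lambda>B. \<Sum>v\<in>{1..n}. indicator (?L v) B)"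
    by (intro integral_mono int)
  also have "\<dots> = (\<Sum>v\<in>{1..n}. measure_pmf.prob ?P (?L v))"
    by (subst Bochner_Integration.integral_sum) (auto intro: int)
  also have "\<dots> \<le> (\<Sum>v\<in>{1..n}. 4 / sqrt t)"
    by (intro sum_mono prob_large_component) (use assms in auto)
  finally have "t * measure_pmf.prob ?P ?M \<le> real n * (4 / sqrt t)" by simp
  then have "measure_pmf.prob ?P ?M \<le> 4 * real n / (t * sqrt t)"
    using t by (simp add: field_simps)
  also have "t * sqrt t = t powr (3 / 2)"
    using t powr_add[of t 1 "1/2"] by (simp add: powr_half_sqrt)
  finally show ?thesis
    by (simp add: random_intersection_graph_def vimage_def)
qed

theorem proposition2p2:
  fixes \<beta> \<gamma> \<mu> :: real
  assumes "\<beta> > 0" and "\<gamma> > 0"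
    and "\<mu> = \<beta> * \<gamma>\<^sup>2" and "\<mu> = 1"
  shows "\<exists>c\<^sub>1 :: real. \<forall>A :: real. A > 1 \<longrightarrow>
    (\<forall>\<^sub>F n :: nat in sequentially.
      measure_pmf.prob (random_intersection_graph n (nat \<lfloor>\<beta> * real n\<rfloor>) (\<gamma> / real n))
        {E. int (max_component_size {1..n} E) > \<lceil>A * real n powr (2 / 3)\<rceil>}
      \<le> c\<^sub>1 / A powr (3 / 2))"
proof (intro exI[of _ 4] allI impI)
  fix A :: real assume A: "A > 1"
  \<comment> \<open>The bound \<open>8 \<le> n\<close> gives \<open>A * n powr (2 / 3) \<ge> 4\<close>; the other two serve the subsolution.\<close>
  have "\<forall>\<^sub>F n in sequentially. max (max 8 \<gamma>) (8 * \<gamma>\<^sup>2) \<le> real n"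
    using filterlim_real_sequentially unfolding filterlim_at_top by blast
  then show "\<forall>\<^sub>F n :: nat in sequentially.
      measure_pmf.prob (random_intersection_graph n (nat \<lfloor>\<beta> * real n\<rfloor>) (\<gamma> / real n))
        {E. int (max_component_size {1..n} E) > \<lceil>A * real n powr (2 / 3)\<rceil>}
      \<le> 4 / A powr (3 / 2)"
  proof eventually_elim
    case (elim n)
    define t where "t = A * real n powr (2 / 3)"
    let ?G = "random_intersection_graph n (nat \<lfloor>\<beta> * real n\<rfloor>) (\<gamma> / real n)"
    have n: "0 < n" using elim by (cases n) auto
    have "(4::real) = 8 powr (2 / 3)"
      using powr_powr[of 2 3 "2/3::real"] by simp
    also have "\<dots> \<le> real n powr (2 / 3)" using elim by (intro powr_mono2) auto
    also have "\<dots> \<le> t" using A mult_right_mono[of 1 A "real n powr (2/3)"] by (simp add: t_def)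
    finally have t: "4 \<le> t" .
    have "real (nat \<lfloor>\<beta> * real n\<rfloor>) \<le> \<beta> * real n"
      using assms by (simp add: of_nat_nat)
    then have "real (nat \<lfloor>\<beta> * real n\<rfloor>) * \<gamma>\<^sup>2 \<le> \<beta> * real n * \<gamma>\<^sup>2"
      by (rule mult_right_mono) simp
    also have "\<dots> = real n" using assms by (simp add: mult_ac)
    finally have m: "real (nat \<lfloor>\<beta> * real n\<rfloor>) * \<gamma>\<^sup>2 \<le> real n" .
    have "measure_pmf.prob ?G {E. int (max_component_size {1..n} E) > \<lceil>t\<rceil>}
          \<le> measure_pmf.prob ?G {E. t < real (max_component_size {1..n} E)}"
      by (rule measure_pmf.finite_measure_mono) (auto simp: ceiling_less_iff intro: le_less_trans[OF le_of_int_ceiling])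
    also have "\<dots> \<le> 4 * real n / t powr (3 / 2)"
      by (rule prob_max_component) (use assms elim m t in auto)
    also have "t powr (3 / 2) = A powr (3 / 2) * real n"
      using A n by (simp add: t_def powr_mult powr_powr)
    finally show ?case using n by (simp add: t_def)
  qed
qed

end
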